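(* Let $A,B\subseteq\mathbb{Z}$ have positive upper Banach densities $\mathrm{BD}(A)=\alpha>0$ and $\mathrm{BD}(B)=\beta>0$, respectively. Then there exists a finite set $F\subseteq\mathbb{Z}$ such that $|F|\le \frac{1}{\alpha\beta}$ and $(A-B)+F$ is thick.
   Context: Notation: $\mathbb{N}=\{1,2,3,\ldots\}$ is the set of positive integers, and $[a,b]=\{x\in\mathbb{Z}\mid a\le x\le b\}$ denotes an interval of integers. For $X,Y\subseteq\mathbb{Z}$, the difference set is $X-Y=\{x-y\mid x\in X,\ y\in Y\}$ and the sumset is $X+Y=\{x+y\mid x\in X,\ y\in Y\}$. A set $X\subseteq\mathbb{Z}$ is thick if for every $k\in\mathbb{N}$ there exists an interval $I=[y+1,y+k]$ of length $k$ (with $y\in\mathbb{Z}$) such that $I\subseteq X$. The upper Banach density of $X\subseteq\mathbb{Z}$ is $\mathrm{BD}(X)=\lim_{n\to\infty}\left(\max_{x\in\mathbb{Z}}\frac{|X\cap[x+1,x+n]|}{n}\right)$; this limit always exists and equals the infimum over $n\in\mathbb{N}$ of the same quantities. *)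

theory Defs
  imports "HOL-Analysis.Analysis" "HOL-Library.Set_Algebras"
begin

text \<open>
  The sumset is the operation \<open>+\<close> on sets from \<open>Set_Algebras\<close>. The operation \<open>-\<close> on sets is the
  set-theoretic difference, so the set of differences needs its own name.
\<close>

definition difference_set :: "int set \<Rightarrow> int set \<Rightarrow> int set" where
  "difference_set X Y = {x - y | x y. x \<in> X \<and> y \<in> Y}"

definition thick :: "int set \<Rightarrow> bool" where
  "thick X \<longleftrightarrow> (\<forall>k::nat. k \<ge> 1 \<longrightarrow> (\<exists>y. {y + 1..y + int k} \<subseteq> X))"

text \<open>
  The maximum over all integers is a genuine one, since only finitely many values occur
  (\<open>finite_range_window_density\<close>). The term for \<open>n = 0\<close> does not affect the limit, which
  always exists by subadditivity.
\<close>

definition window_density :: "int set \<Rightarrow> nat \<Rightarrow> int \<Rightarrow> real" where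
  "window_density X n x = real (card (X \<inter> {x + 1..x + int n})) / real n"

definition BD :: "int set \<Rightarrow> real" where
  "BD X = lim (\<lambda>n. Max (range (window_density X n)))"

lemma finite_range_window_density: "finite (range (window_density X n))"
proof (rule finite_subset)
  have "card (X \<inter> {x + 1..x + int n}) \<le> n" for x
    using card_mono[of "{x + 1..x + int n}" "X \<inter> {x + 1..x + int n}"] by simp
  then show "range (window_density X n) \<subseteq> (\<lambda>k. real k / real n) ` {..n}"
    unfolding window_density_def by auto
qed simp

end

theory Submission
  imports Defs
begin

text \<open>
  Averaging over shifts shows that for every \<open>n\<close> some translate of \<open>B\<close> meets \<open>A\<close> in a set which, moved
  back, is a subset \<open>C n\<close> of \<open>B\<close> inside a window of length \<open>n\<close>, and which has at least about
  \<open>\<alpha> * \<beta> * n\<close> elements (\<open>dense_common_part\<close>). This uses that every length has a window in which \<open>A\<close> is as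
  dense as \<open>BD A\<close> (\<open>exists_dense_window\<close>), a consequence of Fekete's lemma. Differences of elements of
  \<open>C n\<close> are, up to a shift depending on \<open>n\<close>, differences between \<open>A\<close> and \<open>B\<close>. Thus it suffices to
  find one finite set \<open>F\<close> such that arbitrarily long intervals \<open>{1..k}\<close> are covered by
  \<open>(C n - C n) + F\<close> for some \<open>n\<close>.

  A set \<open>F\<close> is a candidate if for infinitely many \<open>n\<close> the translates \<open>C n + f\<close>, \<open>f \<in> F\<close>, are pairwise
  disjoint. Since these translates fit into a window of length \<open>n + O(1)\<close>, a candidate has at most
  \<open>1 / (\<alpha> * \<beta>)\<close> elements (\<open>card_le_of_disjoint_translates\<close>), so there is one of largest size.
  Adding a further point \<open>x\<close> to it destroys disjointness for all large \<open>n\<close>, which says that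
  \<open>C n + x\<close> meets some \<open>C n + f\<close>, that is, \<open>x \<in> (C n - C n) + F\<close>. For finitely many \<open>x\<close> one \<open>n\<close> serves
  simultaneously (\<open>packing_covers_intervals\<close>). Asking for infinitely many \<open>n\<close> instead of fixing one
  \<open>n\<close> is what makes \<open>F\<close> independent of the length of the interval to be covered.
\<close>

section \<open>Fekete's lemma\<close>

lemma subadditive_mult_le:
  fixes u :: "nat \<Rightarrow> real"
  assumes sub: "\<And>m n. u (m + n) \<le> u m + u n"
  shows "u (q * p + r) \<le> real q * u p + u r"
proof (induction q)
  case (Suc q)
  have "u (Suc q * p + r) \<le> u p + u (q * p + r)"
    using sub[of p "q * p + r"] by (simp add: add.assoc)
  with Suc show ?case by (simp add: algebra_simps)
qed simp

text \<open>
  Writing \<open>n = q * p + r\<close> with \<open>r < p\<close>, subadditivity bounds \<open>u n / n\<close> by \<open>u p / p\<close> plus a term that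
  vanishes as \<open>n\<close> grows. Hence the limit superior is at most every single \<open>u p / p\<close>.
\<close>

lemma fekete:
  fixes u :: "nat \<Rightarrow> real"
  assumes sub: "\<And>m n. u (m + n) \<le> u m + u n" and nonneg: "\<And>n. 0 \<le> u n"
  shows "(\<lambda>n. u n / real n) \<longlonglongrightarrow> (INF n\<in>{1..}. u n / real n)"
proof -
  define L where "L = (INF n\<in>{1..}. u n / real n)"
  have bdd: "bdd_below ((\<lambda>n. u n / real n) ` {1..})"
    by (rule bdd_belowI2[of _ 0]) (simp add: nonneg)
  have lower: "L \<le> u n / real n" if "n \<ge> 1" for n
    unfolding L_def using bdd that by (intro cINF_lower) auto
  have "(\<lambda>n. u n / real n) \<longlonglongrightarrow> L"
  proof (rule LIMSEQ_I)
    fix e :: real assume "e > 0"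
    then obtain p where p: "p \<ge> 1" "u p / real p < L + e / 2"
      using cINF_less_iff[of "{1..}" "\<lambda>n. u n / real n" "L + e / 2"] bdd unfolding L_def by auto
    define K where "K = real p * u 1 + u 0"
    have K: "u r \<le> K" if "r < p" for r
    proof -
      have "u r \<le> real r * u 1 + u 0"
        using subadditive_mult_le[of u r 1 0, OF sub] by simp
      also have "\<dots> \<le> K"
        unfolding K_def using that nonneg[of 1] by (intro add_right_mono mult_right_mono) auto
      finally show ?thesis .
    qed
    have K_nonneg: "K \<ge> 0" unfolding K_def by (simp add: nonneg)
    obtain n0 :: nat where n0: "real n0 > 2 * K / e" using reals_Archimedean2 by blast
    show "\<exists>no. \<forall>n\<ge>no. norm (u n / real n - L) < e"
    proof (intro exI allI impI)
      fix n assume n: "n \<ge> max 1 n0"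
      then have npos: "real n > 0" by simp
      have "u n \<le> real (n div p) * u p + u (n mod p)"
        using subadditive_mult_le[of u "n div p" p "n mod p", OF sub] by simp
      also have "\<dots> \<le> (real n / real p) * u p + K"
        using K[of "n mod p"] p nonneg[of p] of_nat_div_le_of_nat[of n p, where ?'a = real]
        by (intro add_mono mult_right_mono) auto
      finally have "u n / real n \<le> u p / real p + K / real n"
        using npos p by (simp add: field_simps)
      moreover have "K / real n < e / 2"
      proof -
        have "2 * K / e < real n" using n0 n by simp
        then show ?thesis using \<open>e > 0\<close> npos by (simp add: field_simps)
      qed
      ultimately have "u n / real n < L + e" using p by linarith
      moreover have "L \<le> u n / real n" using lower n by simp
      ultimately show "norm (u n / real n - L) < e" by simp
    qed
  qed
  then show ?thesis unfolding L_def .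
qed

section \<open>Windows as dense as the upper Banach density\<close>

definition max_window_count :: "int set \<Rightarrow> nat \<Rightarrow> nat" where
  "max_window_count X n = Max (range (\<lambda>x. card (X \<inter> {x + 1..x + int n})))"

lemma finite_range_window_count: "finite (range (\<lambda>x. card (X \<inter> {x + 1..x + int n})))"
proof (rule finite_subset)
  show "range (\<lambda>x. card (X \<inter> {x + 1..x + int n})) \<subseteq> {..n}"
  proof clarsimp
    fix x show "card (X \<inter> {x + 1..x + int n}) \<le> n"
      using card_mono[of "{x + 1..x + int n}" "X \<inter> {x + 1..x + int n}"] by simp
  qed
qed simp

lemma window_count_le_max: "card (X \<inter> {x + 1..x + int n}) \<le> max_window_count X n"
  unfolding max_window_count_def by (intro Max_ge finite_range_window_count) blast

lemma max_window_count_attained: "\<exists>x. card (X \<inter> {x + 1..x + int n}) = max_window_count X n"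
proof -
  have "max_window_count X n \<in> range (\<lambda>x. card (X \<inter> {x + 1..x + int n}))"
    unfolding max_window_count_def by (intro Max_in finite_range_window_count) blast
  then show ?thesis by force
qed

lemma max_window_count_subadditive:
  "max_window_count X (m + n) \<le> max_window_count X m + max_window_count X n"
proof -
  obtain x where x: "card (X \<inter> {x + 1..x + int (m + n)}) = max_window_count X (m + n)"
    using max_window_count_attained by blast
  have "X \<inter> {x + 1..x + int (m + n)}
      = (X \<inter> {x + 1..x + int m}) \<union> (X \<inter> {(x + int m) + 1..(x + int m) + int n})"
    by auto
  then have "card (X \<inter> {x + 1..x + int (m + n)})
      \<le> card (X \<inter> {x + 1..x + int m}) + card (X \<inter> {(x + int m) + 1..(x + int m) + int n})"
    by (simp only: card_Un_le)
  also have "\<dots> \<le> max_window_count X m + max_window_count X n"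
    by (intro add_mono window_count_le_max)
  finally show ?thesis using x by simp
qed

lemma Max_window_density: "Max (range (window_density X n)) = real (max_window_count X n) / real n"
proof -
  have "mono (\<lambda>k. real k / real n)"
    by (intro monoI divide_right_mono) auto
  from mono_Max_commute[OF this finite_range_window_count[of X n]]
  show ?thesis
    unfolding max_window_count_def window_density_def by (simp add: image_image)
qed

lemma BD_le_max_window_count:
  assumes "n \<ge> 1"
  shows "BD X * real n \<le> real (max_window_count X n)"
proof -
  let ?u = "\<lambda>n. real (max_window_count X n)"
  have "(\<lambda>n. ?u n / real n) \<longlonglongrightarrow> (INF n\<in>{1..}. ?u n / real n)"
  proof (rule fekete)
    fix m n show "?u (m + n) \<le> ?u m + ?u n"
      using max_window_count_subadditive[of X m n] by linarith
  qed simp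
  then have "BD X = (INF n\<in>{1..}. ?u n / real n)"
    unfolding BD_def Max_window_density by (rule limI)
  also have "\<dots> \<le> ?u n / real n"
    using assms by (intro cINF_lower bdd_belowI2[of _ 0]) auto
  finally show ?thesis using assms by (simp add: field_simps)
qed

corollary exists_dense_window:
  assumes "n \<ge> 1"
  shows "\<exists>x. BD X * real n \<le> real (card (X \<inter> {x + 1..x + int n}))"
  using BD_le_max_window_count[OF assms] max_window_count_attained by metis

section \<open>A dense common part of one set and a translate of the other\<close>

text \<open>
  Double counting: a pair \<open>(a, b)\<close> contributes to the sum only at the shift \<open>t = a - b\<close>.
\<close>

lemma sum_card_translate_inter:
  fixes X Y :: "int set"
  assumes "finite X" "finite Y" "finite T" and T: "\<And>a b. a \<in> X \<Longrightarrow> b \<in> Y \<Longrightarrow> a - b \<in> T"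
  shows "(\<Sum>t\<in>T. card {b \<in> Y. b + t \<in> X}) = card X * card Y"
proof -
  have "(\<Sum>t\<in>T. card {b \<in> Y. b + t \<in> X}) = card (SIGMA t:T. {b \<in> Y. b + t \<in> X})"
    using assms by (intro card_SigmaI[symmetric]) auto
  also have "\<dots> = card (X \<times> Y)"
  proof (rule bij_betw_same_card)
    show "bij_betw (\<lambda>(t, b). (b + t, b)) (SIGMA t:T. {b \<in> Y. b + t \<in> X}) (X \<times> Y)"
      by (rule bij_betwI[where g = "\<lambda>(a, b). (a - b, b)"]) (use T in auto)
  qed
  finally show ?thesis by (simp add: card_cartesian_product)
qed

text \<open>
  A window of length \<open>n\<close> slides across one of length \<open>n\<^sup>2\<close> in \<open>n\<^sup>2 + n - 1\<close> positions. Every pair of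
  a point of \<open>A\<close> and a point of \<open>B\<close> in these windows coincides in exactly one position, so some position has
  at least the average \<open>\<alpha> n\<^sup>2 * \<beta> n / (n\<^sup>2 + n - 1)\<close> coincidences, where \<open>\<alpha>\<close> and \<open>\<beta>\<close> are the two
  densities. The long window makes the loss at its two ends negligible, and the average is at
  least \<open>\<alpha> * \<beta> * (n - 1)\<close> because \<open>(n - 1) * (n\<^sup>2 + n - 1) = n\<^sup>3 - 2 * n + 1 \<le> n\<^sup>3\<close>.
\<close>

lemma dense_common_part:
  assumes "n \<ge> 1" "BD A \<ge> 0" "BD B \<ge> 0"
  shows "\<exists>C t y. C \<subseteq> B \<inter> {y + 1..y + int n} \<and> (\<forall>c\<in>C. c + t \<in> A)
    \<and> BD A * BD B * (real n - 1) \<le> real (card C)"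
proof -
  obtain x where x: "BD A * real (n\<^sup>2) \<le> real (card (A \<inter> {x + 1..x + int (n\<^sup>2)}))"
    using exists_dense_window[of "n\<^sup>2" A] assms by auto
  obtain y where y: "BD B * real n \<le> real (card (B \<inter> {y + 1..y + int n}))"
    using exists_dense_window assms by blast
  define X where "X = A \<inter> {x + 1..x + int (n\<^sup>2)}"
  define Y where "Y = B \<inter> {y + 1..y + int n}"
  define T where "T = {x + 1 - y - int n..x + int (n\<^sup>2) - y - 1}"
  define C where "C t = {b \<in> Y. b + t \<in> X}" for t
  have card_T: "real (card T) = (real n)\<^sup>2 + real n - 1"
  proof -
    have "card T = nat (int n ^ 2 + int n - 1)" unfolding T_def by simp
    moreover have "int n ^ 2 + int n - 1 \<ge> 0"
      using assms(1) zero_le_power2[of "int n"] by linarith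
    ultimately have "real (card T) = real_of_int (int n ^ 2 + int n - 1)" by simp
    then show ?thesis by simp
  qed
  have total: "(\<Sum>t\<in>T. card (C t)) = card X * card Y"
    unfolding C_def by (rule sum_card_translate_inter) (auto simp: X_def Y_def T_def)
  have "\<exists>t. BD A * BD B * (real n - 1) \<le> real (card (C t))"
  proof (rule ccontr)
    assume "\<not> ?thesis"
    then have less: "real (card (C t)) < BD A * BD B * (real n - 1)" for t by (simp add: not_le)
    have "(real n)\<^sup>2 > 0" using assms(1) by simp
    then have "real (card T) > 0" using card_T assms(1) by linarith
    then have "card T > 0" by simp
    then have "(\<Sum>t\<in>T. real (card (C t))) < (\<Sum>t\<in>T. BD A * BD B * (real n - 1))"
      using less by (intro sum_strict_mono) (auto simp: card_gt_0_iff)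
    also have "\<dots> = BD A * BD B * ((real n - 1) * ((real n)\<^sup>2 + real n - 1))"
      using card_T by simp
    also have "\<dots> \<le> BD A * BD B * (real n) ^ 3"
    proof (intro mult_left_mono)
      show "(real n - 1) * ((real n)\<^sup>2 + real n - 1) \<le> real n ^ 3"
        using assms(1) by (simp add: algebra_simps power2_eq_square power3_eq_cube)
    qed (use assms in simp)
    also have "\<dots> = (BD A * real (n\<^sup>2)) * (BD B * real n)"
      by (simp add: power2_eq_square power3_eq_cube)
    also have "\<dots> \<le> real (card X) * real (card Y)"
      using x y assms unfolding X_def Y_def by (intro mult_mono) auto
    also have "\<dots> = (\<Sum>t\<in>T. real (card (C t)))"
      by (metis total of_nat_mult of_nat_sum)
    finally show False by simp
  qed
  then obtain t where "BD A * BD B * (real n - 1) \<le> real (card (C t))" by blast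
  moreover have "C t \<subseteq> B \<inter> {y + 1..y + int n}" "\<forall>c\<in>C t. c + t \<in> A"
    unfolding C_def X_def Y_def by auto
  ultimately show ?thesis by blast
qed

section \<open>Packing translates and covering intervals\<close>

definition disjoint_translates :: "int set \<Rightarrow> int set \<Rightarrow> bool" where
  "disjoint_translates C F \<longleftrightarrow> disjoint_family_on (\<lambda>f. (\<lambda>c. c + f) ` C) F"

lemma disjoint_translates_iff:
  "disjoint_translates C F \<longleftrightarrow> (\<forall>f\<in>F. \<forall>g\<in>F. f \<noteq> g \<longrightarrow> f - g \<notin> difference_set C C)"
proof -
  have "(\<lambda>c. c + f) ` C \<inter> (\<lambda>c. c + g) ` C = {} \<longleftrightarrow> f - g \<notin> difference_set C C" for f g
  proof -
    have "c + f = c' + g \<longleftrightarrow> f - g = c' - c" for c c' :: int by linarith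
    then have "(\<exists>c\<in>C. \<exists>c'\<in>C. c + f = c' + g) \<longleftrightarrow> f - g \<in> difference_set C C"
      unfolding difference_set_def by blast
    then show ?thesis by blast
  qed
  then show ?thesis unfolding disjoint_translates_def disjoint_family_on_def by simp
qed

lemma card_disjoint_translates_le:
  assumes "disjoint_translates C F" "finite F" "F \<subseteq> {- int M..int M}" "C \<subseteq> {y + 1..y + int n}"
  shows "card F * card C \<le> n + 2 * M"
proof -
  have finC: "finite C" using assms(4) finite_subset by blast
  have "card F * card C = (\<Sum>f\<in>F. card ((\<lambda>c. c + f) ` C))"
    by (simp add: card_image)
  also have "\<dots> = card (\<Union>f\<in>F. (\<lambda>c. c + f) ` C)"
    using assms(1,2) finC unfolding disjoint_translates_def disjoint_family_on_def
    by (intro card_UN_disjoint[symmetric]) auto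
  also have "\<dots> \<le> card {y + 1 - int M..y + int n + int M}"
  proof (intro card_mono)
    show "(\<Union>f\<in>F. (\<lambda>c. c + f) ` C) \<subseteq> {y + 1 - int M..y + int n + int M}"
    proof clarify
      fix f c assume "f \<in> F" "c \<in> C"
      then have "f \<in> {- int M..int M}" "c \<in> {y + 1..y + int n}" using assms(3,4) by blast+
      then show "c + f \<in> {y + 1 - int M..y + int n + int M}" by auto
    qed
  qed simp
  also have "\<dots> = n + 2 * M" by simp
  finally show ?thesis .
qed

text \<open>
  Only boundedly many points separate \<open>n\<close> from the length of a window containing all the translates,
  and this error disappears because \<open>n\<close> may be taken arbitrarily large.
\<close>

lemma card_le_of_disjoint_translates:
  fixes C :: "nat \<Rightarrow> int set"
  assumes window: "\<And>n. n \<ge> 1 \<Longrightarrow> \<exists>y. C n \<subseteq> {y + 1..y + int n}"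
    and dense: "\<And>n. n \<ge> 1 \<Longrightarrow> d * (real n - 1) \<le> real (card (C n))"
    and "finite F" and often: "\<exists>\<^sub>\<infinity>n. disjoint_translates (C n) F"
  shows "real (card F) * d \<le> 1"
proof (rule ccontr)
  define e where "e = real (card F) * d - 1"
  assume "\<not> ?thesis"
  then have "e > 0" unfolding e_def by simp
  define M :: nat where "M = (\<Sum>f\<in>F. nat \<bar>f\<bar>)"
  have M: "F \<subseteq> {- int M..int M}"
  proof
    fix f assume "f \<in> F"
    then have "nat \<bar>f\<bar> \<le> M"
      unfolding M_def using \<open>finite F\<close> by (intro member_le_sum) auto
    then show "f \<in> {- int M..int M}" by auto
  qed
  obtain n0 :: nat where n0: "(2 * real M + 1 + e) / e < real n0" using reals_Archimedean2 by blast
  obtain n where n: "n > n0" "disjoint_translates (C n) F"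
    using often unfolding INFM_nat by blast
  then obtain y where y: "C n \<subseteq> {y + 1..y + int n}" using window[of n] by auto
  have "real (card F) * (d * (real n - 1)) \<le> real (card F) * real (card (C n))"
    using dense[of n] n by (intro mult_left_mono) auto
  also have "\<dots> = real (card F * card (C n))" by simp
  also have "\<dots> \<le> real (n + 2 * M)"
    using card_disjoint_translates_le[OF n(2) \<open>finite F\<close> M y] of_nat_mono by blast
  finally have "(1 + e) * (real n - 1) \<le> real n + 2 * real M"
    unfolding e_def by (simp add: mult.assoc)
  then have "e * real n \<le> 2 * real M + 1 + e" by (simp add: algebra_simps)
  moreover have "2 * real M + 1 + e < e * real n"
  proof -
    have "(2 * real M + 1 + e) / e < real n" using n0 n(1) by simp
    then show ?thesis using \<open>e > 0\<close> by (simp add: field_simps)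
  qed
  ultimately show False by simp
qed

text \<open>
  The covering set is a largest set whose translates are disjoint for infinitely many \<open>n\<close>; the
  preceding bound guarantees that it exists. By maximality, each point outside it becomes covered for
  all but finitely many of these \<open>n\<close>.
\<close>

lemma packing_covers_intervals:
  fixes C :: "nat \<Rightarrow> int set"
  assumes window: "\<And>n. n \<ge> 1 \<Longrightarrow> \<exists>y. C n \<subseteq> {y + 1..y + int n}"
    and dense: "\<And>n. n \<ge> 1 \<Longrightarrow> d * (real n - 1) \<le> real (card (C n))"
    and "d > 0"
  shows "\<exists>F. finite F \<and> real (card F) \<le> 1 / d
    \<and> (\<forall>k. \<exists>n\<ge>1. {1..int k} \<subseteq> difference_set (C n) (C n) + F)"
proof -
  define often where "often F \<longleftrightarrow> finite F \<and> (\<exists>\<^sub>\<infinity>n. disjoint_translates (C n) F)" for F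
  have bound: "real (card F) \<le> 1 / d" if "often F" for F
    using card_le_of_disjoint_translates[OF window dense, of F] that \<open>d > 0\<close>
    unfolding often_def by (simp add: field_simps)
  have "often {}"
    unfolding often_def disjoint_translates_iff by simp
  moreover have "\<forall>F. often F \<longrightarrow> card F < nat \<lceil>1 / d\<rceil> + 1"
  proof (intro allI impI)
    fix F assume "often F"
    then have "real (card F) \<le> real (nat \<lceil>1 / d\<rceil>)"
      by (rule order_trans[OF bound real_nat_ceiling_ge])
    then show "card F < nat \<lceil>1 / d\<rceil> + 1" by simp
  qed
  ultimately have "\<exists>F. often F \<and> (\<forall>G. often G \<longrightarrow> card G \<le> card F)"
    by (rule ex_has_greatest_nat)
  then obtain F where F: "often F" and max: "\<And>G. often G \<Longrightarrow> card G \<le> card F" by blast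
  have finF: "finite F" and inf: "\<exists>\<^sub>\<infinity>n. disjoint_translates (C n) F"
    using F unfolding often_def by blast+
  have extend: "\<forall>\<^sub>\<infinity>n. \<not> disjoint_translates (C n) (insert x F)" if "x \<notin> F" for x
  proof (rule ccontr)
    assume "\<not> ?thesis"
    then have "\<exists>\<^sub>\<infinity>n. disjoint_translates (C n) (insert x F)"
      unfolding frequently_def .
    with finF have "often (insert x F)" unfolding often_def by blast
    from max[OF this] show False using finF that by simp
  qed
  have "\<exists>n\<ge>1. {1..int k} \<subseteq> difference_set (C n) (C n) + F" for k
  proof -
    have "\<forall>\<^sub>\<infinity>n. \<forall>x\<in>{1..int k} - F. \<not> disjoint_translates (C n) (insert x F)"
      using extend by (intro eventually_ball_finite) auto
    moreover have "\<forall>\<^sub>\<infinity>n::nat. n \<ge> 2"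
      by (rule MOST_ge_nat)
    ultimately have "\<exists>\<^sub>\<infinity>n. disjoint_translates (C n) F
        \<and> (\<forall>x\<in>{1..int k} - F. \<not> disjoint_translates (C n) (insert x F)) \<and> n \<ge> 2"
      by (intro INFM_conjI[OF inf] eventually_conj)
    then obtain n where n: "disjoint_translates (C n) F" "n \<ge> 2"
        and not_disj: "\<And>x. x \<in> {1..int k} \<Longrightarrow> x \<notin> F \<Longrightarrow> \<not> disjoint_translates (C n) (insert x F)"
      by (auto dest: INFM_EX)
    have "card (C n) > 0"
    proof -
      have "0 < d * (real n - 1)" using \<open>d > 0\<close> n(2) by simp
      also have "\<dots> \<le> real (card (C n))" using dense n(2) by simp
      finally show ?thesis by simp
    qed
    then obtain c where "c \<in> C n" by fastforce
    then have zero: "0 \<in> difference_set (C n) (C n)"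
      unfolding difference_set_def by force
    have sym: "u - v \<in> difference_set (C n) (C n)" if "v - u \<in> difference_set (C n) (C n)" for u v
    proof -
      from that obtain c c' where "c \<in> C n" "c' \<in> C n" "v - u = c - c'"
        unfolding difference_set_def by blast
      moreover from this have "u - v = c' - c" by linarith
      ultimately show ?thesis unfolding difference_set_def by blast
    qed
    have "x \<in> difference_set (C n) (C n) + F" if x: "x \<in> {1..int k}" for x
    proof (cases "x \<in> F")
      case True
      then show ?thesis using set_plus_intro[OF zero True] by simp
    next
      case False
      then obtain f where "f \<in> F" "x - f \<in> difference_set (C n) (C n)"
        using not_disj[OF x False] n(1) sym unfolding disjoint_translates_iff by blast
      then show ?thesis using set_plus_intro[of "x - f" _ f F] by simp
    qed
    then show ?thesis using n(2) by (intro exI[of _ n]) auto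
  qed
  then show ?thesis using bound[OF F] finF by blast
qed

section \<open>Thickness of a finite union of translates of the difference set\<close>

theorem theorem1p6:
  fixes A B :: "int set" and \<alpha> \<beta> :: real
  assumes "BD A = \<alpha>" and "\<alpha> > 0"
    and "BD B = \<beta>" and "\<beta> > 0"
  shows "\<exists>F :: int set. finite F \<and> real (card F) \<le> 1 / (\<alpha> * \<beta>) \<and> thick (difference_set A B + F)"
proof -
  have "\<forall>n\<in>{1::nat..}. \<exists>C t y. C \<subseteq> B \<inter> {y + 1..y + int n} \<and> (\<forall>c\<in>C. c + t \<in> A)
      \<and> \<alpha> * \<beta> * (real n - 1) \<le> real (card C)"
    using dense_common_part[of _ A B] assms by auto
  then obtain C :: "nat \<Rightarrow> int set" and t y :: "nat \<Rightarrow> int"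
    where parts: "\<forall>n\<in>{1..}. C n \<subseteq> B \<inter> {y n + 1..y n + int n} \<and> (\<forall>c\<in>C n. c + t n \<in> A)
      \<and> \<alpha> * \<beta> * (real n - 1) \<le> real (card (C n))"
    unfolding bchoice_iff by blast
  then have C: "C n \<subseteq> B \<inter> {y n + 1..y n + int n}"
      and shift: "c \<in> C n \<Longrightarrow> c + t n \<in> A"
      and dense: "\<alpha> * \<beta> * (real n - 1) \<le> real (card (C n))" if "n \<ge> 1" for n c
    using that by auto
  obtain F where F: "finite F" "real (card F) \<le> 1 / (\<alpha> * \<beta>)"
    and cover: "\<And>k. \<exists>n\<ge>1. {1..int k} \<subseteq> difference_set (C n) (C n) + F"
  proof -
    have "\<exists>z. C n \<subseteq> {z + 1..z + int n}" if "n \<ge> 1" for n using C[OF that] by blast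
    from packing_covers_intervals[OF this dense] show ?thesis
      using that assms(2,4) by (meson mult_pos_pos)
  qed
  have "thick (difference_set A B + F)"
    unfolding thick_def
  proof (intro allI impI)
    fix k :: nat
    obtain n where n: "n \<ge> 1" "{1..int k} \<subseteq> difference_set (C n) (C n) + F" using cover by blast
    have "{t n + 1..t n + int k} \<subseteq> difference_set A B + F"
    proof
      fix z assume "z \<in> {t n + 1..t n + int k}"
      then have "z - t n \<in> difference_set (C n) (C n) + F" using n(2) by auto
      then obtain c c' f where c: "c \<in> C n" "c' \<in> C n" "f \<in> F" "z - t n = (c - c') + f"
        unfolding difference_set_def by (auto elim!: set_plus_elim)
      then have "(c + t n) - c' \<in> difference_set A B"
        using shift[OF n(1)] C[OF n(1)] unfolding difference_set_def by blast
      then have sum_in: "(c + t n) - c' + f \<in> difference_set A B + F"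
        using \<open>f \<in> F\<close> by (rule set_plus_intro)
      show "z \<in> difference_set A B + F"
      proof -
        have "(c + t n) - c' + f = z" using c(4) by linarith
        with sum_in show ?thesis by simp
      qed
    qed
    then show "\<exists>z. {z + 1..z + int k} \<subseteq> difference_set A B + F" by blast
  qed
  with F show ?thesis by blast
qed

end
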